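(* Every $t$-PLS which verifies $\textsc{acyclic}$ requires labels of size $\Omega((\log n)/t)$, where $n$ is the number of vertices.
   Context: $\textsc{acyclic}$ is the predicate on the family of all connected graph configurations (graph $G=(V,E)$ with state assignment $\varphi:V\to S$) that is true iff the underlying graph is cycle free. A $t$-round proof-labeling scheme ($t$-PLS) consists of a prover assigning a bit string (label) to each vertex and a deterministic distributed verifier running $t$ synchronous rounds (in each round every vertex receives messages from all neighbors, computes, and sends messages), after which each vertex outputs true or false; it must be complete (acyclic configurations are accepted, i.e. all vertices output true, with the prover's labels) and sound (configurations with a cycle are rejected by some vertex under every labeling). Vertices may have unique identifiers and labels may depend on them. Label size is the maximum label length assigned by the prover on legal configurations. *)

theory Defs
  imports Complex_Main "HOL-Library.Multiset"
begin

record 's config =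
  cV  :: "nat set"
  cE  :: "nat \<Rightarrow> nat \<Rightarrow> bool"
  cst :: "nat \<Rightarrow> 's"
  cid :: "nat \<Rightarrow> nat"

definition connected_config :: "'s config \<Rightarrow> bool" where
  "connected_config C \<longleftrightarrow>
     finite (cV C) \<and> cV C \<noteq> {} \<and>
     (\<forall>u v. cE C u v \<longrightarrow> u \<in> cV C \<and> v \<in> cV C) \<and>
     (\<forall>u v. cE C u v \<longrightarrow> cE C v u) \<and>
     (\<forall>u. \<not> cE C u u) \<and>
     (\<forall>u\<in>cV C. \<forall>v\<in>cV C. (cE C)\<^sup>*\<^sup>* u v) \<and>
     inj_on (cid C) (cV C)"

definition has_cycle :: "'s config \<Rightarrow> bool" where
  "has_cycle C \<longleftrightarrow> (\<exists>xs. length xs \<ge> 3 \<and> distinct xs \<and> set xs \<subseteq> cV C \<and>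
      (\<forall>i. Suc i < length xs \<longrightarrow> cE C (xs ! i) (xs ! Suc i)) \<and>
      cE C (last xs) (hd xs))"

definition acyclic_pred :: "'s config \<Rightarrow> bool" where
  "acyclic_pred C \<longleftrightarrow> \<not> has_cycle C"

text \<open>Universal data type for local memories and messages (rich enough to encode any
  finite information built from identifiers, states and labels).\<close>
datatype 's data = DNat nat | DState 's | DBits "bool list" | DList "'s data list"

record 's verifier =
  vinit :: "nat \<Rightarrow> 's \<Rightarrow> bool list \<Rightarrow> 's data"
  vsend :: "nat \<Rightarrow> 's data \<Rightarrow> 's data"
  vupd  :: "nat \<Rightarrow> 's data \<Rightarrow> 's data multiset \<Rightarrow> 's data"
  vout  :: "'s data \<Rightarrow> bool"

fun run :: "'s verifier \<Rightarrow> 's config \<Rightarrow> (nat \<Rightarrow> bool list) \<Rightarrow> nat \<Rightarrow> nat \<Rightarrow> 's data" where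
  "run A C lab 0 v = vinit A (cid C v) (cst C v) (lab v)"
| "run A C lab (Suc k) v =
     vupd A k (run A C lab k v)
       (image_mset (\<lambda>u. vsend A k (run A C lab k u)) (mset_set {u \<in> cV C. cE C v u}))"

definition accepts :: "'s verifier \<Rightarrow> nat \<Rightarrow> 's config \<Rightarrow> (nat \<Rightarrow> bool list) \<Rightarrow> bool" where
  "accepts A t C lab \<longleftrightarrow> (\<forall>v\<in>cV C. vout A (run A C lab t v))"

definition is_PLS_acyclic ::
  "nat \<Rightarrow> 's verifier \<Rightarrow> ('s config \<Rightarrow> nat \<Rightarrow> bool list) \<Rightarrow> bool" where
  "is_PLS_acyclic t A P \<longleftrightarrow>
     (\<forall>C. connected_config C \<and> acyclic_pred C \<longrightarrow> accepts A t C (P C)) \<and>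
     (\<forall>C. connected_config C \<and> \<not> acyclic_pred C \<longrightarrow> (\<forall>lab. \<not> accepts A t C lab))"

end

theory Submission
  imports Defs "HOL-Library.Ramsey"
begin

text \<open>
  Cut a path on n vertices into blocks of 2t consecutive vertices. A radius-t view lies inside two
  consecutive blocks, so acceptance is a relation between consecutive blocks, each given by its
  identifiers and its labels. By Ramsey's theorem there is an infinite supply of identifier blocks
  such that, whenever a block b is followed by a block a with smaller identifiers, this relation
  depends on the labels only. Lay out a path whose blocks alternate between small and large
  identifiers. If labels are short, two blocks at even positions carry the same labels; by
  homogeneity the segment between them closes up to a cycle in which every vertex still accepts.
\<close>

section \<open>Paths and cycles\<close>

text \<open>Every vertex gets the same state \<open>undefined\<close>, so configurations differ only
  in size, shape, identifiers and labels, and the bound holds for every state type.\<close>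

definition path_config :: "nat \<Rightarrow> (nat \<Rightarrow> nat) \<Rightarrow> 's config" where
  "path_config n ident =
     \<lparr>cV = {..<n}, cE = (\<lambda>u v. u < n \<and> v < n \<and> (v = Suc u \<or> u = Suc v)),
      cst = (\<lambda>_. undefined), cid = ident\<rparr>"

definition cycle_config :: "nat \<Rightarrow> (nat \<Rightarrow> nat) \<Rightarrow> 's config" where
  "cycle_config n ident =
     \<lparr>cV = {..<n}, cE = (\<lambda>u v. u < n \<and> v < n \<and> (v = Suc u mod n \<or> u = Suc v mod n)),
      cst = (\<lambda>_. undefined), cid = ident\<rparr>"

lemma path_config_simps [simp]:
  "cV (path_config n ident) = {..<n}"
  "cE (path_config n ident) u v \<longleftrightarrow> u < n \<and> v < n \<and> (v = Suc u \<or> u = Suc v)"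
  "cst (path_config n ident) v = undefined"
  "cid (path_config n ident) = ident"
  by (simp_all add: path_config_def)

lemma cycle_config_simps [simp]:
  "cV (cycle_config n ident) = {..<n}"
  "cE (cycle_config n ident) u v \<longleftrightarrow>
     u < n \<and> v < n \<and> (v = Suc u mod n \<or> u = Suc v mod n)"
  "cst (cycle_config n ident) v = undefined"
  "cid (cycle_config n ident) = ident"
  by (simp_all add: cycle_config_def)

lemma rtranclp_from_zero:
  assumes "\<And>u. Suc u < n \<Longrightarrow> R u (Suc u)" and "v < n"
  shows "R\<^sup>*\<^sup>* 0 v"
  using assms(2)
proof (induction v)
  case (Suc v)
  then show ?case
    using assms(1)[of v] by (meson Suc_lessD rtranclp.rtrancl_into_rtrancl)
qed simp

lemma rtranclp_connected_lessThan:
  assumes "\<And>u v. R u v \<Longrightarrow> R v u" and "\<And>u. Suc u < n \<Longrightarrow> R u (Suc u)"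
    and "u < n" "v < n"
  shows "R\<^sup>*\<^sup>* u v"
proof -
  have "R\<^sup>*\<^sup>* u 0"
    using rtranclp_from_zero[of n R u] assms
    by (metis sympI sympD symp_rtranclp)
  then show ?thesis
    using rtranclp_from_zero[of n R v] assms by (meson rtranclp_trans)
qed

lemma connected_path_config:
  assumes "n > 0" "inj_on ident {..<n}"
  shows "connected_config (path_config n ident)"
  unfolding connected_config_def
  using assms by (auto intro!: rtranclp_connected_lessThan[where n = n])

lemma connected_cycle_config:
  assumes "n \<ge> 2" "inj_on ident {..<n}"
  shows "connected_config (cycle_config n ident)"
proof -
  have "u \<noteq> Suc u mod n" if "u < n" for u
    using assms(1) that by (auto simp: mod_Suc)
  moreover have "{..<n} \<noteq> {}"
    using assms(1) by (auto simp: lessThan_empty_iff)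
  ultimately show ?thesis
    unfolding connected_config_def
    using assms by (auto intro!: rtranclp_connected_lessThan[where n = n])
qed

lemma has_cycle_cycle_config:
  assumes "n \<ge> 3"
  shows "has_cycle (cycle_config n ident)"
  unfolding has_cycle_def
  using assms by (intro exI[of _ "[0..<n]"]) (auto simp: last_conv_nth hd_conv_nth)

text \<open>Both neighbours on a cycle of its largest vertex would be the predecessor of that vertex.\<close>
lemma acyclic_path_config: "acyclic_pred (path_config n ident)"
  unfolding acyclic_pred_def has_cycle_def
proof (rule notI, elim exE conjE)
  fix xs :: "nat list"
  define l where "l = length xs"
  assume l3: "3 \<le> length xs" and dist: "distinct xs"
    and step: "\<forall>i. Suc i < length xs \<longrightarrow> cE (path_config n ident) (xs ! i) (xs ! Suc i)"
    and close: "cE (path_config n ident) (last xs) (hd xs)"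
  have ne: "xs \<noteq> []"
    using l3 by auto
  have next_adj: "xs ! (Suc i mod l) = Suc (xs ! i) \<or> xs ! i = Suc (xs ! (Suc i mod l))"
    if "i < l" for i
  proof (cases "Suc i < l")
    case True
    then show ?thesis using step by (auto simp: l_def)
  next
    case False
    then have "Suc i = l" using that by simp
    then have "i = length xs - 1" "Suc i mod l = 0"
      by (simp_all add: l_def)
    then have "last xs = xs ! i" "hd xs = xs ! (Suc i mod l)"
      using ne by (simp_all add: last_conv_nth hd_conv_nth)
    then show ?thesis using close by auto
  qed
  obtain i where i: "i < l" "xs ! i = Max (set xs)"
    using ne by (metis Max_in List.finite_set in_set_conv_nth l_def set_empty)
  have le: "xs ! j \<le> xs ! i" if "j < l" for j
    using that i by (simp add: l_def)
  \<comment> \<open>The position cyclically before \<open>i\<close>. Having at least three vertices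
    keeps it apart from the position after \<open>i\<close>.\<close>
  define p where "p = (if i = 0 then l - 1 else i - 1)"
  have p: "p < l" "Suc p mod l = i" "p \<noteq> Suc i mod l"
    using i l3 by (auto simp: p_def l_def mod_Suc)
  have "Suc i mod l < l"
    using i by (intro mod_less_divisor) simp
  then have "xs ! i = Suc (xs ! (Suc i mod l))" "xs ! i = Suc (xs ! p)"
    using next_adj[OF i(1)] next_adj[OF p(1)] le[of "Suc i mod l"] le[OF p(1)] p(2) by auto
  then have "xs ! p = xs ! (Suc i mod l)" by simp
  then show False
    using dist p \<open>Suc i mod l < l\<close> by (simp add: nth_eq_iff_index_eq l_def)
qed

section \<open>Executions on the two-way infinite path\<close>

text \<open>A common reference execution for paths and cycles: on the infinite line every position
  has exactly two neighbours, so no boundary cases arise. The sequence \<open>s\<close> supplies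
  identifier and label of each position.\<close>

fun line_run :: "'s verifier \<Rightarrow> (int \<Rightarrow> nat \<times> bool list) \<Rightarrow> nat \<Rightarrow> int \<Rightarrow> 's data" where
  "line_run A s 0 i = vinit A (fst (s i)) undefined (snd (s i))"
| "line_run A s (Suc k) i =
     vupd A k (line_run A s k i)
       {#vsend A k (line_run A s k (i - 1)), vsend A k (line_run A s k (i + 1))#}"

text \<open>Each round enlarges the visible radius by one, so the induction passes from the
  positions \<open>i - 1\<close>, \<open>i\<close>, \<open>i + 1\<close> with radius
  \<open>k\<close> to \<open>i\<close> with radius \<open>Suc k\<close>.\<close>

lemma line_run_local:
  assumes "\<And>d. \<bar>d\<bar> \<le> int k \<Longrightarrow> s (i + d) = s' (i' + d)"
  shows "line_run A s k i = line_run A s' k i'"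
  using assms
proof (induction k arbitrary: i i')
  case 0
  then show ?case by (metis abs_zero add.right_neutral line_run.simps(1) of_nat_0 order_refl)
next
  case (Suc k)
  have "line_run A s k (i + e) = line_run A s' k (i' + e)" if "\<bar>e\<bar> \<le> 1" for e
  proof -
    have "s (i + e + d) = s' (i' + e + d)" if "\<bar>d\<bar> \<le> int k" for d
      using Suc.prems[of "e + d"] that \<open>\<bar>e\<bar> \<le> 1\<close> by (simp add: add.assoc)
    then show ?thesis using Suc.IH by blast
  qed
  from this[of 0] this[of 1] this[of "-1"] show ?case by simp
qed

text \<open>The map \<open>f\<close> acts as a local covering of \<open>C\<close> by the line.
  Neighbourhoods matter only at distance strictly below \<open>k\<close>, since positions at
  distance \<open>k\<close> contribute just their initial data. Distinctness of the two neighbours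
  makes the set of neighbours yield two messages.\<close>

lemma run_eq_line_run:
  assumes "\<And>j. \<bar>j - i\<bar> \<le> int k \<Longrightarrow> s j = (cid C (f j), lab (f j))"
    and "\<And>v. cst C v = undefined"
    and "\<And>j. \<bar>j - i\<bar> < int k \<Longrightarrow>
           {u \<in> cV C. cE C (f j) u} = {f (j - 1), f (j + 1)} \<and> f (j - 1) \<noteq> f (j + 1)"
  shows "run A C lab k (f i) = line_run A s k i"
  using assms(1,3)
proof (induction k arbitrary: i)
  case 0
  then show ?case using assms(2) by simp
next
  case (Suc k)
  have "run A C lab k (f (i + e)) = line_run A s k (i + e)" if "\<bar>e\<bar> \<le> 1" for e
    using that by (intro Suc.IH Suc.prems) auto
  from this[of 0] this[of 1] this[of "-1"] Suc.prems(2)[of i] show ?case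
    by (simp add: add.commute)
qed

lemma run_path_config:
  assumes "\<And>j. 0 \<le> j \<Longrightarrow> j < int n \<Longrightarrow> s j = (ident (nat j), lab (nat j))"
    and "int k \<le> i" "i + int k < int n"
  shows "run A (path_config n ident) lab k (nat i) = line_run A s k i"
proof (rule run_eq_line_run)
  fix j assume "\<bar>j - i\<bar> < int k"
  then show "{u \<in> cV (path_config n ident). cE (path_config n ident) (nat j) u}
      = {nat (j - 1), nat (j + 1)} \<and> nat (j - 1) \<noteq> nat (j + 1)"
    using assms(2,3) by auto
qed (use assms in auto)

text \<open>The line is the universal cover of the cycle. Hence the equation holds for every
  \<open>k\<close>, even when the view wraps around the cycle several times.\<close>

lemma run_cycle_config:
  assumes "n \<ge> 3"
  shows "run A (cycle_config n ident) lab k (nat (i mod int n)) =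
    line_run A (\<lambda>j. (ident (nat (j mod int n)), lab (nat (j mod int n)))) k i"
proof (rule run_eq_line_run[where f = "\<lambda>j. nat (j mod int n)"])
  fix j :: int
  define v where "v = nat (j mod int n)"
  define p where "p = (if v = 0 then n - 1 else v - 1)"
  have v: "v < n" and jv: "j mod int n = int v"
    using assms by (auto simp: v_def nat_less_iff)
  have succ: "nat ((j + 1) mod int n) = Suc v mod n"
    by (metis jv mod_add_left_eq nat_int of_nat_Suc zmod_int add.commute)
  have "(j - 1) mod int n = (int v - 1) mod int n"
    by (metis jv mod_diff_left_eq)
  also have "\<dots> = int p"
    using v assms by (auto simp: p_def zmod_minus1 mod_pos_pos_trivial)
  finally have pred: "nat ((j - 1) mod int n) = p" by simp
  have "{u. u < n \<and> (u = Suc v mod n \<or> v = Suc u mod n)} = {p, Suc v mod n} \<and> p \<noteq> Suc v mod n"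
    using v assms by (auto simp: p_def mod_Suc split: if_splits)
  then show "{u \<in> cV (cycle_config n ident). cE (cycle_config n ident) (nat (j mod int n)) u}
      = {nat ((j - 1) mod int n), nat ((j + 1) mod int n)}
      \<and> nat ((j - 1) mod int n) \<noteq> nat ((j + 1) mod int n)"
    using v unfolding succ pred by (auto simp: v_def[symmetric])
qed auto

section \<open>Blocks\<close>

text \<open>A block is a pair of a block number and the list of labels of its vertices; the
  identifiers in block number a of width w are w * a, ..., w * a + w - 1.\<close>

definition block_seq :: "nat \<Rightarrow> (int \<Rightarrow> nat \<times> bool list list) \<Rightarrow> int \<Rightarrow> nat \<times> bool list" where
  "block_seq w \<beta> i = (w * fst (\<beta> (i div int w)) + nat (i mod int w),
                      snd (\<beta> (i div int w)) ! nat (i mod int w))"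

text \<open>The two blocks occupy positions 0 to 4t - 1, and the positions tested are exactly those
  whose radius-\<open>t\<close> view stays inside. The value of the sequence elsewhere is therefore
  irrelevant.\<close>

definition compatible ::
  "'s verifier \<Rightarrow> nat \<Rightarrow> nat \<times> bool list list \<Rightarrow> nat \<times> bool list list \<Rightarrow> bool" where
  "compatible A t x y \<longleftrightarrow> (\<forall>i\<in>{int t..<3 * int t}.
     vout A (line_run A (block_seq (2 * t) (\<lambda>q. if q = 0 then x else y)) t i))"

lemma compatible_iff:
  assumes "t \<ge> 1"
  shows "compatible A t (\<beta> q) (\<beta> (q + 1)) \<longleftrightarrow> (\<forall>i\<in>{int t..<3 * int t}.
     vout A (line_run A (block_seq (2 * t) \<beta>) t (i + 2 * int t * q)))"
proof -
  have "line_run A (block_seq (2 * t) (\<lambda>r. if r = 0 then \<beta> q else \<beta> (q + 1))) t i =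
        line_run A (block_seq (2 * t) \<beta>) t (i + 2 * int t * q)"
    if i: "i \<in> {int t..<3 * int t}" for i
  proof (rule line_run_local)
    fix d :: int assume "\<bar>d\<bar> \<le> int t"
    then have x: "0 \<le> i + d" "i + d < 4 * int t"
      using i by auto
    define r where "r = (i + d) div (2 * int t)"
    \<comment> \<open>The view meets only the two blocks numbered \<open>q\<close> and
      \<open>q + 1\<close>.\<close>
    have "r = 0 \<or> r = 1"
    proof -
      have "0 \<le> r" using x by (simp add: r_def pos_imp_zdiv_nonneg_iff)
      moreover have "r < 2"
      proof (rule ccontr)
        assume "\<not> r < 2"
        then have "2 * int t * 2 \<le> 2 * int t * r"
          by (intro mult_left_mono) auto
        moreover have "2 * int t * r + (i + d) mod (2 * int t) = i + d"
          by (simp add: r_def)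
        moreover have "0 \<le> (i + d) mod (2 * int t)"
          using assms by simp
        ultimately show False using x by linarith
      qed
      ultimately show ?thesis by auto
    qed
    moreover have shift: "i + 2 * int t * q + d = (i + d) + q * (2 * int t)"
      by simp
    have "(i + 2 * int t * q + d) div (2 * int t) = q + r"
      and "(i + 2 * int t * q + d) mod (2 * int t) = (i + d) mod (2 * int t)"
      unfolding shift r_def using assms by (simp_all only: div_mult_self1 mod_mult_self1)
    ultimately show "block_seq (2 * t) (\<lambda>r. if r = 0 then \<beta> q else \<beta> (q + 1)) (i + d) =
        block_seq (2 * t) \<beta> (i + 2 * int t * q + d)"
      by (auto simp: block_seq_def r_def[symmetric])
  qed
  then show ?thesis by (simp add: compatible_def)
qed

text \<open>The windows from t to 3t - 1, shifted by multiples of 2t, tile the integers, so each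
  position is tested by one consecutive pair of blocks.\<close>

lemma vout_if_compatible:
  assumes "t \<ge> 1" and "\<And>q. compatible A t (\<beta> q) (\<beta> (q + 1))"
  shows "vout A (line_run A (block_seq (2 * t) \<beta>) t i)"
proof -
  define q where "q = (i - int t) div (2 * int t)"
  define r where "r = (i - int t) mod (2 * int t)"
  have "i - int t = r + 2 * int t * q"
    by (simp add: q_def r_def)
  moreover have "0 \<le> r" "r < 2 * int t"
    using assms(1) by (simp_all add: r_def)
  ultimately have "i = (r + int t) + 2 * int t * q" "r + int t \<in> {int t..<3 * int t}"
    by auto
  then show ?thesis
    using assms(2)[of q] compatible_iff[OF assms(1)] by metis
qed

text \<open>Division by \<open>w\<close> recovers block number and offset from an identifier. The
  bound on \<open>n\<close> keeps all block indices at most \<open>m\<close>, where \<open>b\<close>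
  is injective.\<close>

lemma inj_on_block_ids:
  fixes b :: "nat \<Rightarrow> nat"
  assumes "w > 0" "inj_on b {..m}" "n \<le> w * Suc m"
  shows "inj_on (\<lambda>v. w * b (v div w) + v mod w) {..<n}"
proof (rule inj_onI)
  fix u v
  assume uv: "u \<in> {..<n}" "v \<in> {..<n}"
    and eq: "w * b (u div w) + u mod w = w * b (v div w) + v mod w"
  have "(w * b (x div w) + x mod w) div w = b (x div w)"
    "(w * b (x div w) + x mod w) mod w = x mod w" for x
    using assms(1) by simp_all
  then have "b (u div w) = b (v div w)" and r: "u mod w = v mod w"
    using eq by metis+
  moreover have "x div w \<le> m" if "x < n" for x
    using that assms
    by (simp add: less_Suc_eq_le[symmetric] div_less_iff_less_mult mult.commute del: mult_Suc_right)
  ultimately have "u div w = v div w"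
    using uv assms(2) by (auto dest: inj_onD)
  with r show "u = v" by (metis div_mult_mod_eq)
qed

section \<open>Ramsey argument\<close>

lemma infinite_homogeneous_set:
  fixes col :: "nat \<Rightarrow> nat \<Rightarrow> 'c"
  assumes "finite F" "\<And>a b. col a b \<in> F"
  obtains H c where "infinite H" "\<And>a b. a \<in> H \<Longrightarrow> b \<in> H \<Longrightarrow> a < b \<Longrightarrow> col a b = c"
proof -
  obtain enc :: "'c \<Rightarrow> nat" and s where enc: "enc ` F = {i. i < s}" "inj_on enc F"
    using finite_imp_inj_to_nat_seg[OF assms(1)] by metis
  \<comment> \<open>\<open>Ramsey2\<close> colours unordered pairs with numbers: \<open>Min\<close>
    and \<open>Max\<close> restore the increasing order, and \<open>enc\<close> numbers the finite
    palette.\<close>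
  define f where "f X = enc (col (Min X) (Max X))" for X
  have "\<forall>x\<in>UNIV. \<forall>y\<in>UNIV. x \<noteq> y \<longrightarrow> f {x, y} < s"
    using enc(1) assms(2) by (auto simp: f_def)
  from Ramsey2[OF infinite_UNIV_nat this] obtain H k
    where H: "infinite H" "\<forall>x\<in>H. \<forall>y\<in>H. x \<noteq> y \<longrightarrow> f {x, y} = k"
    by blast
  have "col a b = inv_into F enc k" if "a \<in> H" "b \<in> H" "a < b" for a b
  proof -
    have "enc (col a b) = k"
      using H(2) that by (force simp: f_def min_def max_def)
    then show ?thesis
      using enc(2) assms(2) by (metis inv_into_f_f)
  qed
  with H(1) show ?thesis by (rule that)
qed

lemma alternating_enumeration:
  fixes H :: "nat set" and m :: nat
  assumes "infinite H"
  obtains b where "inj_on b {..m}" "\<And>q. b q \<in> H"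
    "\<And>p q. p \<le> m \<Longrightarrow> even p \<Longrightarrow> odd q \<Longrightarrow> b p < b q"
proof -
  \<comment> \<open>The shift by \<open>Suc m\<close> lifts every odd position above all even
    positions up to \<open>m\<close>.\<close>
  define b where "b q = enumerate H (if even q then q else Suc m + q)" for q
  have "inj_on b {..m}"
    using strict_mono_enumerate[OF assms]
    by (auto intro!: inj_onI simp: b_def strict_mono_eq split: if_splits)
  moreover have "b q \<in> H" for q
    using assms by (simp add: b_def enumerate_in_set)
  moreover have "b p < b q" if "p \<le> m" "even p" "odd q" for p q
    using that assms by (simp add: b_def enumerate_mono)
  ultimately show ?thesis using that by blast
qed

lemma card_bool_lists_le:
  "finite {w :: bool list. length w \<le> l}" "card {w :: bool list. length w \<le> l} \<le> 2 ^ Suc l"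
proof -
  have "card {w :: bool list. length w \<le> l} = (\<Sum>i\<le>l. 2 ^ i)"
    using card_lists_length_le[of "UNIV :: bool set" l] by simp
  also have "\<dots> = 2 ^ Suc l - 1"
    by (induction l) auto
  finally show "card {w :: bool list. length w \<le> l} \<le> 2 ^ Suc l" by simp
  show "finite {w :: bool list. length w \<le> l}"
    using finite_lists_length_le[of "UNIV :: bool set" l] by simp
qed

section \<open>The lower bound\<close>

lemma long_label_exists:
  fixes A :: "'s verifier"
  assumes pls: "is_PLS_acyclic t A P" and t: "t \<ge> 1"
    and n: "2 * t * (2 * (2 ^ Suc l) ^ (2 * t) + 1) \<le> n"
  shows "\<exists>C. connected_config C \<and> acyclic_pred C \<and> card (cV C) = n \<and>
           (\<exists>v\<in>cV C. length (P C v) > l)"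
proof (rule ccontr)
  assume "\<not> ?thesis"
  then have short: "length (P C v) \<le> l"
    if "connected_config C" "acyclic_pred C" "card (cV C) = n" "v \<in> cV C" for C v
    using that not_le by blast
  \<comment> \<open>Bounds the number of label lists that a block can carry when all labels have
    length at most \<open>l\<close>.\<close>
  define K :: nat where "K = (2 ^ Suc l) ^ (2 * t)"
  define \<Lambda> where "\<Lambda> = {ws. set ws \<subseteq> {w :: bool list. length w \<le> l} \<and> length ws = 2 * t}"
  have fin: "finite \<Lambda>"
    unfolding \<Lambda>_def by (intro finite_lists_length_eq card_bool_lists_le)
  have "card \<Lambda> = card {w :: bool list. length w \<le> l} ^ (2 * t)"
    unfolding \<Lambda>_def by (intro card_lists_length_eq card_bool_lists_le)
  then have cardL: "card \<Lambda> \<le> K"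
    unfolding K_def using card_bool_lists_le(2) by (simp only: power_mono)

  \<comment> \<open>The colour of a pair is a whole relation on label lists. The order is reversed:
    block \<open>b\<close>, the larger number when homogeneity is applied, comes first on the
    path.\<close>
  define col where "col a b = {(\<mu>, \<nu>). \<mu> \<in> \<Lambda> \<and> \<nu> \<in> \<Lambda> \<and> compatible A t (b, \<mu>) (a, \<nu>)}" for a b
  have "finite (Pow (\<Lambda> \<times> \<Lambda>))" and "\<And>a b. col a b \<in> Pow (\<Lambda> \<times> \<Lambda>)"
    using fin by (auto simp: col_def)
  then obtain H c where H: "infinite H"
    and hom: "\<And>a b. a \<in> H \<Longrightarrow> b \<in> H \<Longrightarrow> a < b \<Longrightarrow> col a b = c"
    by (rule infinite_homogeneous_set[where col = col]) blast
  \<comment> \<open>The number of complete blocks; an incomplete block with index \<open>m\<close>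
    may follow them, and its identifiers must be distinct from the others too.\<close>
  define m where "m = n div (2 * t)"
  have m: "2 * K < m"
    using n t by (simp add: m_def K_def less_eq_div_iff_mult_less_eq Suc_le_eq[symmetric] algebra_simps
        del: power_Suc)
  have mn: "2 * t * m \<le> n"
    by (simp add: m_def)
  have nm: "n \<le> 2 * t * Suc m"
    using t dividend_less_times_div[of "2 * t" n] by (simp add: m_def)
  obtain b where b: "inj_on b {..m}" "\<And>q. b q \<in> H"
    "\<And>p q. p \<le> m \<Longrightarrow> even p \<Longrightarrow> odd q \<Longrightarrow> b p < b q"
    using alternating_enumeration[OF H, of m] by metis
  define ident where "ident v = 2 * t * b (v div (2 * t)) + v mod (2 * t)" for v
  have inj: "inj_on ident {..<n}"
    unfolding ident_def using inj_on_block_ids[OF _ b(1) nm] t by simp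
  define C :: "'s config" where "C = path_config n ident"
  have npos: "n > 0"
    using n t by (cases n) auto
  have C: "connected_config C" "acyclic_pred C" "card (cV C) = n"
    unfolding C_def using connected_path_config[OF npos inj] acyclic_path_config by auto
  define lam where "lam q = map (\<lambda>j. P C (2 * t * q + j)) [0..<2 * t]" for q
  have lamL: "lam q \<in> \<Lambda>" if "q < m" for q
  proof -
    have "2 * t * q + j < n" if "j < 2 * t" for j
    proof -
      have "2 * t * q + j < 2 * t * Suc q" using that by simp
      also have "\<dots> \<le> 2 * t * m" using \<open>q < m\<close> by (intro mult_le_mono) auto
      finally show ?thesis using mn by simp
    qed
    then have "length (P C (2 * t * q + j)) \<le> l" if "j < 2 * t" for j
      using that short[OF C] by (simp add: C_def)
    then show ?thesis by (auto simp: \<Lambda>_def lam_def)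
  qed
  have at: "(2 * t * b p + s, lam p ! s) = (ident (2 * t * p + s), P C (2 * t * p + s))"
    if "s < 2 * t" for p s
    using that by (simp add: ident_def lam_def)

  \<comment> \<open>Completeness makes all vertices of the path accept, and the views tested here
    stay inside the path because both blocks are complete.\<close>
  have step: "compatible A t (b q, lam q) (b (Suc q), lam (Suc q))" if q: "Suc q < m" for q
  proof -
    \<comment> \<open>\<open>nat\<close> repeats block 0 at negative indices; no view considered
      below reaches those positions.\<close>
    define \<beta> where "\<beta> q = (b (nat q), lam (nat q))" for q :: int
    have seq: "block_seq (2 * t) \<beta> x = (ident (nat x), P C (nat x))" if "0 \<le> x" for x
    proof -
      have "nat x = 2 * t * nat (x div int (2 * t)) + nat (x mod int (2 * t))"
        using that by (simp add: nat_div_distrib nat_mod_distrib nat_mult_distrib)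
      moreover have "nat (x mod int (2 * t)) < 2 * t"
        using t by (simp add: nat_less_iff)
      ultimately show ?thesis
        using at[of "nat (x mod int (2 * t))" "nat (x div int (2 * t))"]
        by (simp add: block_seq_def \<beta>_def)
    qed
    have "vout A (line_run A (block_seq (2 * t) \<beta>) t (i + 2 * int t * int q))"
      if i: "i \<in> {int t..<3 * int t}" for i
    proof -
      define x where "x = i + 2 * int t * int q"
      have "x + int t < 2 * int t * (int q + 2)"
        using i by (simp add: x_def algebra_simps)
      also have "\<dots> \<le> 2 * int t * int m"
        using q by (intro mult_left_mono) auto
      also have "\<dots> \<le> int n"
        using mn by (metis of_nat_le_iff of_nat_mult of_nat_numeral)
      finally have hi: "x + int t < int n" .
      have "0 \<le> 2 * int t * int q" by simp
      then have lo: "int t \<le> x"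
        using i unfolding x_def atLeastLessThan_iff by linarith
      have "run A C (P C) t (nat x) = line_run A (block_seq (2 * t) \<beta>) t x"
        unfolding C_def using seq lo hi by (intro run_path_config) (auto simp: C_def)
      moreover have "nat x \<in> cV C"
        using hi lo by (simp add: C_def)
      moreover have "accepts A t C (P C)"
        using pls C by (simp add: is_PLS_acyclic_def)
      ultimately show ?thesis
        unfolding accepts_def x_def[symmetric] by metis
    qed
    then have "compatible A t (\<beta> (int q)) (\<beta> (int q + 1))"
      unfolding compatible_iff[OF t] by blast
    then show ?thesis
      by (simp add: \<beta>_def nat_add_distrib)
  qed

  \<comment> \<open>Pigeonhole: the K + 1 even positions from 0 to 2K share at most \<open>K\<close>
    label lists.\<close>
  have "\<not> inj_on (\<lambda>j. lam (2 * j)) {..K}"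
  proof
    assume "inj_on (\<lambda>j. lam (2 * j)) {..K}"
    moreover have "(\<lambda>j. lam (2 * j)) ` {..K} \<subseteq> \<Lambda>"
      using m lamL by auto
    ultimately have "card {..K} \<le> card \<Lambda>"
      using fin card_inj_on_le by blast
    then show False using cardL by simp
  qed
  then obtain i j where ij: "i < j" "j \<le> K" "lam (2 * i) = lam (2 * j)"
    using linorder_inj_onI'[of "{..K}" "\<lambda>j. lam (2 * j)"] unfolding atMost_iff by blast
  have jm: "2 * j < m"
    using ij(2) m by linarith
  define g where "g = 2 * (j - i)"
  define N where "N = 2 * t * g"
  have g: "g \<ge> 2" "2 * i + g = 2 * j"
    using ij by (auto simp: g_def)
  have "2 * 2 \<le> 2 * t * g"
    using g t by (intro mult_le_mono) auto
  then have N: "N \<ge> 3" unfolding N_def by linarith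
  have "2 * t * (2 * i) + N = 2 * t * (2 * j)"
    unfolding N_def g(2)[symmetric] by (rule distrib_left[symmetric])
  also have "\<dots> \<le> 2 * t * m"
    using jm by (intro mult_le_mono) auto
  finally have Nn: "2 * t * (2 * i) + N \<le> n" using mn by simp

  \<comment> \<open>The periodic unrolling of the segment formed by blocks \<open>2 * i\<close> to
    \<open>2 * j - 1\<close>.\<close>
  define \<gamma> where "\<gamma> q = (b (2 * i + nat (q mod int g)), lam (2 * i + nat (q mod int g)))" for q
  have compat: "compatible A t (\<gamma> q) (\<gamma> (q + 1))" for q
  proof -
    define r where "r = nat (q mod int g)"
    have r: "r < g" and qr: "q mod int g = int r"
      using g by (auto simp: r_def nat_less_iff)
    have "nat ((q + 1) mod int g) = Suc r mod g"
      by (metis qr mod_add_left_eq nat_int of_nat_Suc zmod_int add.commute)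
    then have \<gamma>: "\<gamma> q = (b (2 * i + r), lam (2 * i + r))"
      "\<gamma> (q + 1) = (b (2 * i + Suc r mod g), lam (2 * i + Suc r mod g))"
      by (simp_all add: \<gamma>_def r_def)
    have st: "compatible A t (b (2 * i + r), lam (2 * i + r)) (b (2 * i + Suc r), lam (2 * i + Suc r))"
      using step[of "2 * i + r"] r g jm by simp
    show ?thesis
    proof (cases "Suc r = g")
      case False
      then show ?thesis using st r by (simp add: \<gamma>)
    next
      case True
      \<comment> \<open>The closing junction. The last block \<open>p\<close> of the segment is
        followed by block \<open>2 * j\<close> on the path and by block \<open>2 * i\<close> on the
        cycle. As \<open>p\<close> is odd, \<open>b p\<close> exceeds both of their numbers, so the
        two colours agree, and the two label lists are equal by choice.\<close>
      define p where "p = 2 * i + r"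
      have p: "Suc p = 2 * j" "p < m" "odd p"
        using True g jm unfolding p_def by presburger+
      have "(lam p, lam (2 * j)) \<in> col (b (2 * j)) (b p)"
        using st p jm lamL by (simp add: col_def flip: p_def)
      also have "col (b (2 * j)) (b p) = col (b (2 * i)) (b p)"
        using hom b(2) b(3)[of "2 * j" p] b(3)[of "2 * i" p] p jm ij(1) by simp
      finally have "compatible A t (b p, lam p) (b (2 * i), lam (2 * i))"
        using ij(3) by (simp add: col_def)
      then show ?thesis using True by (simp add: \<gamma> p_def)
    qed
  qed

  define ident' where "ident' v = ident (2 * t * (2 * i) + v)" for v
  define lab' where "lab' v = P C (2 * t * (2 * i) + v)" for v
  define D :: "'s config" where "D = cycle_config N ident'"
  have "inj_on ident' {..<N}"
  proof (rule inj_onI)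
    fix u v assume "u \<in> {..<N}" "v \<in> {..<N}" "ident' u = ident' v"
    then have "2 * t * (2 * i) + u = 2 * t * (2 * i) + v"
      using Nn inj_onD[OF inj, of "2 * t * (2 * i) + u" "2 * t * (2 * i) + v"]
      by (simp add: ident'_def)
    then show "u = v" by simp
  qed
  then have D: "connected_config D" "\<not> acyclic_pred D"
    unfolding D_def acyclic_pred_def
    using N by (auto intro: connected_cycle_config has_cycle_cycle_config)
  \<comment> \<open>Unrolling the cycle \<open>D\<close> gives exactly the periodic block sequence,
    so compatibility of its blocks makes every vertex of \<open>D\<close> accept, against
    soundness.\<close>
  have seq: "block_seq (2 * t) \<gamma> x = (ident' (nat (x mod int N)), lab' (nat (x mod int N)))" for x
  proof -
    define q where "q = nat (x div int (2 * t) mod int g)"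
    define s where "s = nat (x mod int (2 * t))"
    have s: "s < 2 * t"
      using t by (simp add: s_def nat_less_iff)
    have "x mod int N = int (2 * t) * (x div int (2 * t) mod int g) + x mod int (2 * t)"
      unfolding N_def of_nat_mult[of "2 * t" g] by (rule zmod_zmult2_eq) simp
    also have "\<dots> = int (2 * t * q + s)"
      using g t by (simp add: q_def s_def)
    finally have "nat (x mod int N) = 2 * t * q + s" by (simp only: nat_int)
    moreover have "2 * t * (2 * i) + (2 * t * q + s) = 2 * t * (2 * i + q) + s"
      by (simp add: algebra_simps)
    ultimately show ?thesis
      using at[OF s, of "2 * i + q"]
      by (simp only: block_seq_def \<gamma>_def ident'_def lab'_def fst_conv snd_conv q_def[symmetric] s_def[symmetric])
  qed
  have "vout A (run A D lab' t v)" if "v < N" for v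
  proof -
    have "run A D lab' t (nat (int v mod int N)) = line_run A (block_seq (2 * t) \<gamma>) t (int v)"
      unfolding D_def run_cycle_config[OF N] seq[abs_def] ..
    then show ?thesis
      using that vout_if_compatible[OF t, of A \<gamma>] compat by simp
  qed
  then have "accepts A t D lab'"
    by (simp add: accepts_def D_def)
  then show False
    using pls D by (auto simp: is_PLS_acyclic_def)
qed

text \<open>The block count is at most the product of two factors, each at most
  \<open>sqrt (real n)\<close>. The constant 1/4 gives 2tl at most half of
  \<open>ln (real n)\<close>, which with \<open>ln 2 \<le> 1\<close> bounds
  \<open>2 ^ (2 * t * l)\<close>; the threshold on \<open>n\<close> bounds
  \<open>6 * t * 4 ^ t\<close>.\<close>

lemma block_count_bound:
  fixes n t :: nat
  assumes t: "t \<ge> 1" and n: "(6 * t * 4 ^ t)\<^sup>2 \<le> n"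
    and l: "real l \<le> 1 / 4 * ln (real n) / real t"
  shows "2 * t * (2 * (2 ^ Suc l) ^ (2 * t) + 1) \<le> n"
proof -
  have "1 \<le> (6 * t * 4 ^ t)\<^sup>2"
    using t by (simp add: Suc_le_eq)
  then have n1: "n \<ge> 1" using n by simp
  have root: "real (6 * t * 4 ^ t) \<le> sqrt (real n)"
    using n by (intro real_le_rsqrt) (metis of_nat_le_iff of_nat_power)
  have "2 * real t * real l \<le> ln (real n) / 2"
    using l t by (simp add: field_simps)
  moreover have "ln (2 :: real) \<le> 1"
    using ln_le_minus_one[of 2] by simp
  moreover have "2 * real t * real l * ln 2 \<le> 2 * real t * real l * 1"
    using calculation(2) by (intro mult_left_mono) auto
  ultimately have e: "real (2 * t * l) * ln 2 \<le> ln (real n) / 2"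
    by simp
  have "(2 :: real) ^ (2 * t * l) = exp (real (2 * t * l) * ln 2)"
    by (metis exp_ln exp_of_nat_mult zero_less_numeral)
  also have "\<dots> \<le> exp (ln (real n) / 2)"
    using e by simp
  also have "\<dots> = sqrt (real n)"
    using n1 by (simp add: ln_sqrt[symmetric])
  finally have p: "(2 :: real) ^ (2 * t * l) \<le> sqrt (real n)" .
  have pw: "((2 :: real) ^ Suc l) ^ (2 * t) = 4 ^ t * 2 ^ (2 * t * l)"
  proof -
    have "((2 :: real) ^ Suc l) ^ (2 * t) = 2 ^ (2 * t) * 2 ^ (2 * t * l)"
      by (simp add: power_mult_distrib power_mult[symmetric] mult.commute)
    then show ?thesis by (simp add: power_mult)
  qed
  \<comment> \<open>Absorbs the summand 1 into a third copy of the main term, whence the factor 6 =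
    2 * 3.\<close>
  have one: "1 \<le> (4 :: real) ^ t * sqrt (real n)"
    using mult_mono[of 1 "4 ^ t :: real" 1 "sqrt (real n)"] n1 by simp
  have "real (2 * t * (2 * (2 ^ Suc l) ^ (2 * t) + 1))
      = 2 * real t * (2 * (4 ^ t * 2 ^ (2 * t * l)) + 1)"
    using pw by (simp only: of_nat_mult of_nat_add of_nat_power of_nat_numeral of_nat_1)
  also have "\<dots> \<le> 2 * real t * (2 * (4 ^ t * sqrt (real n)) + 4 ^ t * sqrt (real n))"
    using p one by (intro mult_left_mono add_mono) auto
  also have "\<dots> = real (6 * t * 4 ^ t) * sqrt (real n)"
    by simp
  also have "\<dots> \<le> sqrt (real n) * sqrt (real n)"
    using root by (intro mult_right_mono) auto
  also have "\<dots> = real n" by simp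
  finally show ?thesis by (simp only: of_nat_le_iff)
qed

theorem theorem3:
  "\<exists>c::real. c > 0 \<and>
     (\<forall>t::nat. t \<ge> 1 \<longrightarrow>
       (\<forall>(A :: 's verifier) P. is_PLS_acyclic t A P \<longrightarrow>
          (\<exists>n0. \<forall>n\<ge>n0. \<exists>C. connected_config C \<and> acyclic_pred C \<and> card (cV C) = n \<and>
               (\<exists>v\<in>cV C. real (length (P C v)) \<ge> c * ln (real n) / real t))))"
proof (intro exI[of _ "1 / 4 :: real"] conjI allI impI)
  fix t :: nat and A :: "'s verifier" and P
  assume t: "t \<ge> 1" and pls: "is_PLS_acyclic t A P"
  show "\<exists>n0. \<forall>n\<ge>n0. \<exists>C. connected_config C \<and> acyclic_pred C \<and> card (cV C) = n \<and>
          (\<exists>v\<in>cV C. real (length (P C v)) \<ge> 1 / 4 * ln (real n) / real t)"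
  proof (intro exI[of _ "(6 * t * 4 ^ t)\<^sup>2"] allI impI)
    fix n assume n: "(6 * t * 4 ^ t)\<^sup>2 \<le> n"
    define x where "x = 1 / 4 * ln (real n) / real t"
    \<comment> \<open>Rounding down costs nothing: a length strictly above \<open>l\<close> is at
      least \<open>l + 1\<close>, hence at least \<open>x\<close>.\<close>
    define l where "l = nat \<lfloor>x\<rfloor>"
    have "1 \<le> (6 * t * 4 ^ t)\<^sup>2"
      using t by (simp add: Suc_le_eq)
    then have "x \<ge> 0" using n by (simp add: x_def)
    then have l: "real l \<le> x" "x \<le> real l + 1"
      unfolding l_def by linarith+
    obtain C v where C: "connected_config C" "acyclic_pred C" "card (cV C) = n"
      "v \<in> cV C" "length (P C v) > l"
      using long_label_exists[OF pls t block_count_bound[OF t n]] l(1) unfolding x_def by blast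
    have "x \<le> real (length (P C v))"
      using l(2) C(5) by linarith
    then show "\<exists>C. connected_config C \<and> acyclic_pred C \<and> card (cV C) = n \<and>
          (\<exists>v\<in>cV C. real (length (P C v)) \<ge> 1 / 4 * ln (real n) / real t)"
      using C unfolding x_def by blast
  qed
qed simp

end
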